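(* Let $a,b>0$, $c=\sqrt{a^2+b^2}$, and let $\gamma(t)=(a\cosh t,\,b\sinh t)$, $t\in\mathbb{R}$, be a branch of the hyperbola with foci $F=(c,0)$ and $F'=(-c,0)$. Fix $t_0\in\mathbb{R}$. (1) The roulette of $F$ as $\gamma$ rolls on a straight line, with arc length measured from $t_0$, is $C_1(t)=(g_n^1(t),f_n^1(t))$ with $$g_n^1(t)=\int_{t_0}^t\sqrt{c^2\cosh^2 z-a^2}\,dz-\frac{c\sinh t\,(c\cosh t-a)}{\sqrt{c^2\cosh^2 t-a^2}},\qquad f_n^1(t)=\frac{b(c\cosh t-a)}{\sqrt{c^2\cosh^2 t-a^2}}.$$ Moreover $|C_1'(t)|=\dfrac{ab}{c\cosh t+a}$ and $$\int_{t_0}^t|C_1'(z)|\,dz=\left.2a\arctan\left(\sqrt{\tfrac{c-a}{c+a}}\tanh\tfrac z2\right)\right|_{z=t_0}^{z=t};$$ in particular, the length of $C_1$ over $t\in(-\infty,\infty)$ is $4a\arctan\sqrt{\tfrac{c-a}{c+a}}=2a\arctan\tfrac ba$. (2) The roulette of $F'$, with arc length measured from $t_0$, is $C_2(t)=(g_n^2(t),f_n^2(t))$ with $$g_n^2(t)=\int_{t_0}^t\sqrt{c^2\cosh^2 z-a^2}\,dz-\frac{c\sinh t\,(c\cosh t+a)}{\sqrt{c^2\cosh^2 t-a^2}},\qquad f_n^2(t)=\frac{b(c\cosh t+a)}{\sqrt{c^2\cosh^2 t-a^2}}.$$ Moreover $|C_2'(t)|=\dfrac{ab}{c\cosh t-a}$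 and $$\int_{t_0}^t|C_2'(z)|\,dz=\left.2a\arctan\left(\sqrt{\tfrac{c+a}{c-a}}\tanh\tfrac z2\right)\right|_{z=t_0}^{z=t}.$$ (3) The sum of the lengths of $C_1$ and $C_2$ over $t\in(-\infty,\infty)$ is $2\pi a$.
   Context: Roulette of a point under rolling on a straight line: let $P(t)$ be a regular smooth plane curve with unit tangent $T(t)=P'(t)/|P'(t)|$, let $\Phi$ be a fixed point of the plane of the curve (here a focus), and let $s(t)=\int_{t_0}^t|P'(z)|\,dz$ be the signed arc length from $t_0$. Let $Q(t)$ be the orthogonal projection of $\Phi$ onto the tangent line to the curve at $P(t)$. When the curve rolls without slipping on a straight line (taken as the abscissa axis), the roulette of $\Phi$ is the curve with abscissa $s(t)-\langle P(t)-Q(t),T(t)\rangle$ and ordinate the distance $|\Phi-Q(t)|$. *)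

theory Defs
  imports "HOL-Analysis.Analysis"
begin

type_synonym plane = "real \<times> real"

definition velocity :: "(real \<Rightarrow> plane) \<Rightarrow> real \<Rightarrow> plane" where
  "velocity P t = vector_derivative P (at t)"

definition unit_tangent :: "(real \<Rightarrow> plane) \<Rightarrow> real \<Rightarrow> plane" where
  "unit_tangent P t = velocity P t /\<^sub>R norm (velocity P t)"

(* The interval integral is oriented: it changes sign when t < t0. *)
definition signed_arc_length :: "(real \<Rightarrow> plane) \<Rightarrow> real \<Rightarrow> real \<Rightarrow> real" where
  "signed_arc_length P t0 t = (LBINT z=t0..t. norm (velocity P z))"

(* Extended nonnegative values, so that a curve of infinite length has length \<infinity> and not
   the default value 0 of a non-existent Bochner integral. *)
definition total_length :: "(real \<Rightarrow> plane) \<Rightarrow> ennreal" where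
  "total_length P = (\<integral>\<^sup>+ z. ennreal (norm (velocity P z)) \<partial>lborel)"

definition tangent_line :: "(real \<Rightarrow> plane) \<Rightarrow> real \<Rightarrow> plane set" where
  "tangent_line P t = {P t + r *\<^sub>R unit_tangent P t | r. True}"

definition tangent_foot :: "(real \<Rightarrow> plane) \<Rightarrow> plane \<Rightarrow> real \<Rightarrow> plane" where
  "tangent_foot P \<Phi> t =
     (THE q. q \<in> tangent_line P t \<and> orthogonal (\<Phi> - q) (unit_tangent P t))"

lemma tangent_foot_unique:
  assumes "velocity P t \<noteq> 0"
  shows "\<exists>!q. q \<in> tangent_line P t \<and> orthogonal (\<Phi> - q) (unit_tangent P t)"
proof -
  define T where "T = unit_tangent P t"
  have "norm T = 1" using assms by (simp add: T_def unit_tangent_def)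
  then have T: "T \<bullet> T = 1" by (simp add: norm_eq_1)
  have orth: "orthogonal (\<Phi> - (P t + r *\<^sub>R T)) T \<longleftrightarrow> r = (\<Phi> - P t) \<bullet> T" for r
    by (auto simp: orthogonal_def inner_diff_left inner_add_left T)
  show ?thesis
    unfolding tangent_line_def T_def[symmetric]
    by (rule ex1I[of _ "P t + ((\<Phi> - P t) \<bullet> T) *\<^sub>R T"]) (use orth in auto)
qed

(* The roulette of the point \<Phi> when the regular curve P rolls on the abscissa axis, with arc
   length measured from t0. *)
definition roulette :: "(real \<Rightarrow> plane) \<Rightarrow> plane \<Rightarrow> real \<Rightarrow> real \<Rightarrow> plane" where
  "roulette P \<Phi> t0 t =
     (signed_arc_length P t0 t - (P t - tangent_foot P \<Phi> t) \<bullet> unit_tangent P t,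
      norm (\<Phi> - tangent_foot P \<Phi> t))"

end

(* Let w be the speed of the hyperbola, and treat the foci (\<sigma> c, 0) for \<sigma> = 1, -1 together.
   Because w^2 = (c cosh t - \<sigma> a)(c cosh t + \<sigma> a), the velocity of the roulette collapses to a
   scalar multiple of (b, c sinh t), and this vector has norm w because w^2 = c^2 sinh^2 t + b^2.
   The speed a b / (c cosh t + \<sigma> a) is integrated by the substitution tanh (t / 2). The moduli
   sqrt ((c - a) / (c + a)) and sqrt ((c + a) / (c - a)) of the two primitives are mutually
   inverse, so their arctangents sum to pi / 2 and the two lengths to 2 pi a. *)
theory Submission
  imports Defs
begin

section \<open>Roulettes in Cartesian coordinates\<close>

lemma tangent_foot_eq:
  assumes "velocity P t \<noteq> 0"
  shows "tangent_foot P \<Phi> t = P t + ((\<Phi> - P t) \<bullet> unit_tangent P t) *\<^sub>R unit_tangent P t"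
  unfolding tangent_foot_def
proof (rule the1_equality[OF tangent_foot_unique[OF assms]])
  have "norm (unit_tangent P t) = 1"
    using assms by (simp add: unit_tangent_def)
  then have "unit_tangent P t \<bullet> unit_tangent P t = 1"
    by (simp add: norm_eq_1)
  then show "P t + ((\<Phi> - P t) \<bullet> unit_tangent P t) *\<^sub>R unit_tangent P t \<in> tangent_line P t \<and>
      orthogonal (\<Phi> - (P t + ((\<Phi> - P t) \<bullet> unit_tangent P t) *\<^sub>R unit_tangent P t))
        (unit_tangent P t)"
    by (auto simp: tangent_line_def orthogonal_def inner_diff_left inner_add_left)
qed

text \<open>Removes the foot and the unit tangent from later computations. With D = \<Phi> - P, the
  abscissa correction is the dot product of -D with the velocity over the speed, and the ordinate is
  the absolute cross product of D with the velocity over the speed.\<close>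

lemma roulette_coordinates:
  assumes "velocity P t = (u, v)" and "norm (velocity P t) = w" and "w > 0"
    and "P t = (x, y)" and "\<Phi> = (p, q)"
  shows "roulette P \<Phi> t0 t =
    (signed_arc_length P t0 t - ((x - p) * u + (y - q) * v) / w,
     \<bar>(p - x) * v - (q - y) * u\<bar> / w)"
proof -
  have "velocity P t \<noteq> 0"
    using assms(2,3) by auto
  note foot = tangent_foot_eq[OF this, of \<Phi>]
  have T: "unit_tangent P t = (u / w, v / w)"
    unfolding unit_tangent_def assms(2) unfolding assms(1) by (simp add: field_simps)
  define \<alpha> \<beta> where "\<alpha> = u / w" and "\<beta> = v / w"
  have uv: "u = w * \<alpha>" "v = w * \<beta>"
    using \<open>w > 0\<close> by (simp_all add: \<alpha>_def \<beta>_def)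
  have w: "u\<^sup>2 + v\<^sup>2 = w\<^sup>2"
    using assms(2) by (auto simp: assms(1) norm_Pair)
  have "\<alpha>\<^sup>2 + \<beta>\<^sup>2 = (u\<^sup>2 + v\<^sup>2) / w\<^sup>2"
    by (simp add: \<alpha>_def \<beta>_def power_divide add_divide_distrib)
  also have "\<dots> = 1"
    unfolding w using \<open>w > 0\<close> by simp
  finally have \<alpha>\<beta>: "\<alpha>\<^sup>2 + \<beta>\<^sup>2 = 1" .
  \<comment> \<open>Since \<open>(\<beta>, - \<alpha>)\<close> is a unit normal, \<open>k\<close> is
    the signed distance from \<Phi> to the tangent line.\<close>
  define k where "k = (p - x) * \<beta> - (q - y) * \<alpha>"
  have "p - (x + ((p - x) * \<alpha> + (q - y) * \<beta>) * \<alpha>) = k * \<beta>"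
    and "q - (y + ((p - x) * \<alpha> + (q - y) * \<beta>) * \<beta>) = k * (- \<alpha>)"
    using \<alpha>\<beta> unfolding k_def by algebra+
  then have "\<Phi> - tangent_foot P \<Phi> t = k *\<^sub>R (\<beta>, - \<alpha>)"
    unfolding foot T by (simp add: assms(4,5) \<alpha>_def \<beta>_def)
  then have "norm (\<Phi> - tangent_foot P \<Phi> t) = \<bar>k\<bar> * norm (\<beta>, - \<alpha>)"
    by (simp only: norm_scaleR)
  also have "norm (\<beta>, - \<alpha>) = 1"
    using \<alpha>\<beta> by (simp add: norm_Pair add.commute)
  also have "\<bar>k\<bar> * 1 = \<bar>(p - x) * v - (q - y) * u\<bar> / w"
  proof -
    have "(p - x) * v - (q - y) * u = w * k"
      unfolding k_def uv by (simp add: algebra_simps)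
    then show ?thesis
      using \<open>w > 0\<close> by (simp add: abs_mult)
  qed
  finally have 2: "norm (\<Phi> - tangent_foot P \<Phi> t) = \<bar>(p - x) * v - (q - y) * u\<bar> / w" .
  \<comment> \<open>The factor \<open>\<alpha>\<^sup>2 + \<beta>\<^sup>2\<close> is the square of
    the unit tangent. Kept explicit, it makes this step a pure ring identity; it is replaced by 1
    afterwards.\<close>
  have "(P t - tangent_foot P \<Phi> t) \<bullet> unit_tangent P t
      = - ((p - x) * \<alpha> + (q - y) * \<beta>) * (\<alpha>\<^sup>2 + \<beta>\<^sup>2)"
    unfolding foot T
    by (simp add: assms(4,5) \<alpha>_def[symmetric] \<beta>_def[symmetric] power2_eq_square algebra_simps)
  also have "\<dots> = ((x - p) * u + (y - q) * v) / w"
    using \<open>w > 0\<close> unfolding uv \<alpha>\<beta> by (simp add: field_simps)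
  finally show ?thesis
    unfolding roulette_def 2 by simp
qed

section \<open>Differentiating integrals and computing lengths from primitives\<close>

lemma has_real_derivative_interval_integral:
  fixes f :: "real \<Rightarrow> real" and t0 t :: real
  assumes "continuous_on UNIV f"
  shows "((\<lambda>u::real. LBINT z=t0..u. f z) has_real_derivative f t) (at t)"
proof -
  \<comment> \<open>The margin of 1 on each side puts \<open>t\<close> in the interior of an
    interval that also contains \<open>t0\<close>, so the one-sided issue at the endpoints
    disappears and both orders of \<open>t0\<close> and \<open>t\<close> are covered.\<close>
  define l r where "l = min t0 t - 1" and "r = max t0 t + 1"
  have "((\<lambda>u::real. LBINT z=t0..u. f z) has_vector_derivative f t) (at t within {l..r})"
    by (rule interval_integral_FTC2)
      (auto simp: l_def r_def intro: continuous_on_subset[OF assms])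
  moreover have "at t within {l..r} = at t"
    by (rule at_within_interior) (auto simp: l_def r_def)
  ultimately show ?thesis
    by (simp add: has_real_derivative_iff_has_vector_derivative)
qed

lemma signed_arc_length_eq_primitive:
  assumes "\<And>t. (G has_real_derivative norm (velocity P t)) (at t)"
    and "continuous_on UNIV (\<lambda>t. norm (velocity P t))"
  shows "signed_arc_length P t0 t = G t - G t0"
  unfolding signed_arc_length_def
  by (rule interval_integral_FTC_finite)
    (use assms in \<open>auto simp: has_real_derivative_iff_has_vector_derivative
      intro: continuous_on_subset has_vector_derivative_at_within\<close>)

text \<open>The integrand is nonnegative and its primitive has finite limits, so the improper
  integral converges absolutely; the Bochner integral over the line then agrees with the extended
  nonnegative one.\<close>

lemma total_length_eq_primitive:
  assumes "\<And>t. (G has_real_derivative norm (velocity P t)) (at t)"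
    and "continuous_on UNIV (\<lambda>t. norm (velocity P t))"
    and "(G \<longlongrightarrow> A) at_bot" and "(G \<longlongrightarrow> B) at_top"
  shows "total_length P = ennreal (B - A)"
proof -
  have cont: "isCont (\<lambda>t. norm (velocity P t)) t" for t
    using assms(2) by (simp add: continuous_on_eq_continuous_at)
  have UNIV: "einterval (-\<infinity>) \<infinity> = UNIV"
    by (auto simp: einterval_def)
  note FTC = interval_integral_FTC_nonneg[where f = "\<lambda>t. norm (velocity P t)"
      and F = G and a = "-\<infinity>" and b = "\<infinity>" and A = A and B = B]
  have "set_integrable lborel (einterval (-\<infinity>) \<infinity>) (\<lambda>t. norm (velocity P t))"
    by (rule FTC(1)) (use assms(1,3,4) cont in \<open>auto simp: ereal_tendsto_simps\<close>)
  moreover have "(LBINT t=-\<infinity>..\<infinity>. norm (velocity P t)) = B - A"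
    by (rule FTC(2)) (use assms(1,3,4) cont in \<open>auto simp: ereal_tendsto_simps\<close>)
  ultimately show ?thesis
    unfolding total_length_def UNIV set_integrable_def interval_lebesgue_integral_def
      set_lebesgue_integral_def
    by (simp add: nn_integral_eq_integral)
qed

section \<open>The branch and its speed\<close>

locale hyperbola =
  fixes a b c :: real
  assumes a_pos: "a > 0" and b_pos: "b > 0" and c_eq: "c = sqrt (a\<^sup>2 + b\<^sup>2)"
begin

definition branch :: "real \<Rightarrow> plane" where
  "branch t = (a * cosh t, b * sinh t)"

definition speed :: "real \<Rightarrow> real" where
  "speed t = sqrt (c\<^sup>2 * (cosh t)\<^sup>2 - a\<^sup>2)"

lemma c_square: "c\<^sup>2 = a\<^sup>2 + b\<^sup>2"
  by (simp add: c_eq)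

lemma a_less_c: "a < c"
  unfolding c_eq using a_pos b_pos by (intro real_less_rsqrt) auto

text \<open>Follows from \<open>c > a\<close> and \<open>cosh t \<ge> 1\<close>. It keeps the
  radicand of \<open>speed\<close> and both focal factors positive.\<close>

lemma a_less_c_cosh: "a < c * cosh t"
  using a_less_c a_pos cosh_real_ge_1[of t] mult_left_mono[of 1 "cosh t" c] by linarith

lemma speed_square: "(speed t)\<^sup>2 = c\<^sup>2 * (cosh t)\<^sup>2 - a\<^sup>2"
  unfolding speed_def
  using power_strict_mono[OF a_less_c_cosh, of 2 t] a_pos by (simp add: power_mult_distrib)

text \<open>Combines cosh^2 = sinh^2 + 1 with c^2 - a^2 = b^2. As a sum of squares with b > 0, this
  form makes positivity evident.\<close>

lemma speed_square_sinh: "(speed t)\<^sup>2 = c\<^sup>2 * (sinh t)\<^sup>2 + b\<^sup>2"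
  unfolding speed_square using c_square by (simp add: cosh_square_eq algebra_simps)

lemma speed_pos: "speed t > 0"
proof -
  have "(speed t)\<^sup>2 > 0"
    unfolding speed_square_sinh using b_pos by (simp add: add_nonneg_pos)
  then show ?thesis
    unfolding speed_square unfolding speed_def by (simp only: real_sqrt_gt_zero)
qed

lemma velocity_branch: "velocity branch t = (a * sinh t, b * cosh t)"
  unfolding velocity_def branch_def
  by (rule vector_derivative_at) (auto intro!: derivative_eq_intros
      simp: has_real_derivative_iff_has_vector_derivative[symmetric])

lemma norm_velocity_branch: "norm (velocity branch t) = speed t"
proof -
  have "(a * sinh t)\<^sup>2 + (b * cosh t)\<^sup>2 = c\<^sup>2 * (cosh t)\<^sup>2 - a\<^sup>2"
    by (simp add: c_square cosh_square_eq algebra_simps)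
  then show ?thesis
    by (simp add: velocity_branch norm_Pair speed_def)
qed

lemma signed_arc_length_branch:
  "signed_arc_length branch t0 t = (LBINT z=t0..t. speed z)"
  by (simp add: signed_arc_length_def norm_velocity_branch)

lemma has_real_derivative_speed:
  "(speed has_real_derivative c\<^sup>2 * sinh t * cosh t / speed t) (at t)"
proof -
  have "c\<^sup>2 * (cosh t)\<^sup>2 - a\<^sup>2 > 0"
    using speed_pos[of t] by (simp add: speed_def)
  then show ?thesis
    unfolding speed_def by (auto intro!: derivative_eq_intros simp: field_simps)
qed

lemma continuous_on_speed: "continuous_on UNIV speed"
  using has_real_derivative_speed by (intro DERIV_continuous_on) (auto intro: DERIV_subset)

section \<open>Roulettes of both foci in one computation\<close>

context
  fixes \<sigma> :: real
  assumes sign: "\<sigma> = 1 \<or> \<sigma> = - 1"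
begin

text \<open>These factors are the distances from \<open>branch t\<close> to the foci (\<sigma> c, 0)
  and (-\<sigma> c, 0) respectively.\<close>

lemma focal_factor_pos: "c * cosh t - \<sigma> * a > 0" "c * cosh t + \<sigma> * a > 0"
  using sign a_less_c_cosh[of t] a_pos by auto

lemma speed_square_factor: "(speed t)\<^sup>2 = (c * cosh t - \<sigma> * a) * (c * cosh t + \<sigma> * a)"
  unfolding speed_square using sign by (auto simp: algebra_simps power2_eq_square)

lemma roulette_branch:
  "roulette branch (\<sigma> * c, 0) t0 t =
    ((LBINT z=t0..t. speed z) - c * sinh t * (c * cosh t - \<sigma> * a) / speed t,
     b * (c * cosh t - \<sigma> * a) / speed t)"
proof -
  have "(a * cosh t - \<sigma> * c) * (a * sinh t) + (b * sinh t - 0) * (b * cosh t)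
      = (a\<^sup>2 + b\<^sup>2) * sinh t * cosh t - \<sigma> * c * a * sinh t"
    by (simp add: algebra_simps power2_eq_square)
  also have "\<dots> = c * sinh t * (c * cosh t - \<sigma> * a)"
    unfolding c_square[symmetric] by (simp add: algebra_simps power2_eq_square)
  finally have 1: "(a * cosh t - \<sigma> * c) * (a * sinh t) + (b * sinh t - 0) * (b * cosh t)
      = c * sinh t * (c * cosh t - \<sigma> * a)" .
  have "(\<sigma> * c - a * cosh t) * (b * cosh t) - (0 - b * sinh t) * (a * sinh t)
      = b * (\<sigma> * c * cosh t - a)"
    using cosh_square_eq[of t] by (simp add: power2_eq_square) algebra
  \<comment> \<open>Uses \<sigma>^2 = 1. The sign \<sigma> records that the two foci lie on opposite
    sides of the tangent; the absolute value then discards it.\<close>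
  also have "\<dots> = \<sigma> * (b * (c * cosh t - \<sigma> * a))"
    using sign by (auto simp: algebra_simps)
  also have "\<bar>\<dots>\<bar> = b * (c * cosh t - \<sigma> * a)"
    using sign b_pos focal_factor_pos(1)[of t] by (auto simp: abs_mult)
  finally have 2: "\<bar>(\<sigma> * c - a * cosh t) * (b * cosh t) - (0 - b * sinh t) * (a * sinh t)\<bar>
      = b * (c * cosh t - \<sigma> * a)" .
  show ?thesis
    using roulette_coordinates[OF velocity_branch norm_velocity_branch speed_pos branch_def refl,
        of "\<sigma> * c" 0 t0 t]
    unfolding 1 2 signed_arc_length_branch .
qed

lemma has_vector_derivative_roulette:
  "(roulette branch (\<sigma> * c, 0) t0 has_vector_derivative
     (\<sigma> * a * b / (speed t * (c * cosh t + \<sigma> * a))) *\<^sub>R (b, c * sinh t)) (at t)"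
proof -
  \<comment> \<open>The distances from the point of the branch to the chosen focus and to the other
    one; their product is the squared speed.\<close>
  define n q where "n = c * cosh t - \<sigma> * a" and "q = c * cosh t + \<sigma> * a"
  have q: "q > 0"
    unfolding q_def by (rule focal_factor_pos)
  have w: "speed t > 0"
    by (rule speed_pos)
  have wnq: "(speed t)\<^sup>2 = n * q"
    unfolding n_def q_def by (rule speed_square_factor)
  \<comment> \<open>Both quotient-rule derivatives end in a multiple of
    \<open>n / (speed t)^3\<close>; this identity leaves only \<open>speed t\<close> and
    \<open>q\<close> in the denominator.\<close>
  have n: "n / (speed t)^3 = 1 / (speed t * q)"
  proof -
    have "n > 0"
      unfolding n_def by (rule focal_factor_pos)
    moreover have "(speed t)^3 = speed t * (n * q)"
      unfolding wnq[symmetric] by (simp add: power2_eq_square power3_eq_cube)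
    ultimately show ?thesis
      by simp
  qed
  have wb: "(speed t)\<^sup>2 = c\<^sup>2 * (sinh t)\<^sup>2 + b\<^sup>2"
    by (rule speed_square_sinh)
  have "((\<lambda>t. b * (c * cosh t - \<sigma> * a) / speed t) has_real_derivative
      (b * (c * sinh t) * speed t - b * n * (c\<^sup>2 * sinh t * cosh t / speed t))
        / (speed t * speed t)) (at t)"
    using w unfolding n_def by (auto intro!: derivative_eq_intros has_real_derivative_speed)
  also have "(b * (c * sinh t) * speed t - b * n * (c\<^sup>2 * sinh t * cosh t / speed t))
        / (speed t * speed t) = b * c * sinh t * ((speed t)\<^sup>2 - n * (c * cosh t)) / (speed t)^3"
    using w by (simp add: field_simps power2_eq_square power3_eq_cube)
  \<comment> \<open>Here \<open>n * q - n * (c * cosh t)\<close> is \<open>n\<close> times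
    \<open>q - c * cosh t\<close>, which is \<sigma> a. The same cancellation drives the abscissa
    below.\<close>
  also have "(speed t)\<^sup>2 - n * (c * cosh t) = \<sigma> * a * n"
    unfolding wnq q_def by (simp add: algebra_simps)
  also have "b * c * sinh t * (\<sigma> * a * n) / (speed t)^3
      = b * c * sinh t * \<sigma> * a * (n / (speed t)^3)"
    by simp
  also have "\<dots> = \<sigma> * a * b / (speed t * q) * (c * sinh t)"
    unfolding n by simp
  finally have f: "((\<lambda>t. b * (c * cosh t - \<sigma> * a) / speed t) has_real_derivative
      \<sigma> * a * b / (speed t * q) * (c * sinh t)) (at t)" .
  have "((\<lambda>t. (LBINT z=t0..t. speed z) - c * sinh t * (c * cosh t - \<sigma> * a) / speed t)
      has_real_derivative
      speed t - ((c * cosh t * n + c * sinh t * (c * sinh t)) * speed t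
         - c * sinh t * n * (c\<^sup>2 * sinh t * cosh t / speed t)) / (speed t * speed t)) (at t)"
    using w unfolding n_def
    by (auto intro!: derivative_eq_intros has_real_derivative_speed
        has_real_derivative_interval_integral continuous_on_speed simp: algebra_simps)
  \<comment> \<open>Grouped so that the difference
    \<open>(speed t)\<^sup>2 - n * (c * cosh t)\<close> appears twice, once on its own and once
    multiplied by \<open>(c * sinh t)\<^sup>2\<close>.\<close>
  also have "speed t - ((c * cosh t * n + c * sinh t * (c * sinh t)) * speed t
         - c * sinh t * n * (c\<^sup>2 * sinh t * cosh t / speed t)) / (speed t * speed t)
      = ((speed t)\<^sup>2 - c * cosh t * n - (c * sinh t)\<^sup>2 * ((speed t)\<^sup>2 - n * (c * cosh t))
          / (speed t)\<^sup>2) / speed t"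
    using w by (simp add: field_simps power2_eq_square)
  also have "(speed t)\<^sup>2 - n * (c * cosh t) = \<sigma> * a * n"
    by fact
  also have "(speed t)\<^sup>2 - c * cosh t * n = \<sigma> * a * n"
    unfolding wnq q_def by (simp add: algebra_simps)
  also have "(\<sigma> * a * n - (c * sinh t)\<^sup>2 * (\<sigma> * a * n) / (speed t)\<^sup>2) / speed t
      = \<sigma> * a * n * ((speed t)\<^sup>2 - (c * sinh t)\<^sup>2) / (speed t)^3"
    using w by (simp add: field_simps power2_eq_square power3_eq_cube)
  also have "(speed t)\<^sup>2 - (c * sinh t)\<^sup>2 = b\<^sup>2"
    unfolding wb by (simp add: power_mult_distrib)
  also have "\<sigma> * a * n * b\<^sup>2 / (speed t)^3 = \<sigma> * a * b\<^sup>2 * (n / (speed t)^3)"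
    by simp
  also have "\<dots> = \<sigma> * a * b / (speed t * q) * b"
    unfolding n by (simp add: power2_eq_square)
  finally have g: "((\<lambda>t. (LBINT z=t0..t. speed z) - c * sinh t * (c * cosh t - \<sigma> * a) / speed t)
      has_real_derivative \<sigma> * a * b / (speed t * q) * b) (at t)" .
  show ?thesis
    unfolding roulette_branch[abs_def]
    using has_vector_derivative_Pair[OF g[unfolded has_real_derivative_iff_has_vector_derivative]
        f[unfolded has_real_derivative_iff_has_vector_derivative]]
    unfolding q_def by simp
qed

lemma norm_velocity_roulette:
  "norm (velocity (roulette branch (\<sigma> * c, 0) t0) t) = a * b / (c * cosh t + \<sigma> * a)"
proof -
  have "norm (b, c * sinh t) = speed t"
    using speed_square_sinh[of t] speed_pos[of t]
    by (auto simp: norm_Pair power_mult_distrib add.commute intro!: real_sqrt_unique)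
  then show ?thesis
    unfolding velocity_def vector_derivative_at[OF has_vector_derivative_roulette] norm_scaleR
    using speed_pos[of t] focal_factor_pos(2)[of t] a_pos b_pos sign
    by (auto simp: abs_mult)
qed

section \<open>Arc length of the roulettes\<close>

definition arc_primitive :: "real \<Rightarrow> real" where
  "arc_primitive t = 2 * a * arctan (sqrt ((c - \<sigma> * a) / (c + \<sigma> * a)) * tanh (t / 2))"

text \<open>Since b^2 = (c - \<sigma> a)(c + \<sigma> a), the root is rational in a, b, c, which
  keeps radicals out of the differentiation and of the arctangent identity.\<close>

lemma modulus_eq: "sqrt ((c - \<sigma> * a) / (c + \<sigma> * a)) = b / (c + \<sigma> * a)"
proof (rule real_sqrt_unique)
  \<comment> \<open>The focal factor at \<open>t = 0\<close>, where cosh is 1.\<close>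
  have "c + \<sigma> * a > 0"
    using focal_factor_pos(2)[of 0] by simp
  moreover have "b\<^sup>2 = (c - \<sigma> * a) * (c + \<sigma> * a)"
    using sign c_square by (auto simp: algebra_simps power2_eq_square)
  ultimately show "(b / (c + \<sigma> * a))\<^sup>2 = (c - \<sigma> * a) / (c + \<sigma> * a)"
    and "0 \<le> b / (c + \<sigma> * a)"
    using b_pos by (auto simp: power_divide power2_eq_square)
qed

lemma has_real_derivative_arc_primitive:
  "(arc_primitive has_real_derivative a * b / (c * cosh t + \<sigma> * a)) (at t)"
proof -
  define d C S where "d = c + \<sigma> * a" and "C = cosh (t / 2)" and "S = sinh (t / 2)"
  have d: "d > 0"
    using focal_factor_pos(2)[of 0] by (simp add: d_def)
  have C: "C > 0"
    by (simp add: C_def)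
  have CS: "C\<^sup>2 = S\<^sup>2 + 1"
    by (simp add: C_def S_def cosh_square_eq)
  have cosh_t: "cosh t = C\<^sup>2 + S\<^sup>2"
    using cosh_double[of "t / 2"] by (simp add: C_def S_def)
  have bd: "b\<^sup>2 = (c - \<sigma> * a) * d"
    using sign c_square unfolding d_def by (auto simp: algebra_simps power2_eq_square)
  \<comment> \<open>The chain rule is carried out for an arbitrary modulus \<open>s\<close>, which
    is specialised to \<open>b / d\<close> only afterwards.\<close>
  have "((\<lambda>t. 2 * a * arctan (s * tanh (t / 2))) has_real_derivative
      a * s * (1 - (tanh (t / 2))\<^sup>2) / (1 + (s * tanh (t / 2))\<^sup>2)) (at t)" for s
  proof -
    have "((\<lambda>t. tanh (t / 2)) has_real_derivative (1 - (tanh (t / 2))\<^sup>2) * (1 / 2)) (at t)"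
      by (auto intro!: derivative_eq_intros)
    then have "((\<lambda>t. s * tanh (t / 2)) has_real_derivative
        s * ((1 - (tanh (t / 2))\<^sup>2) * (1 / 2))) (at t)"
      by (rule DERIV_cmult)
    then have "((\<lambda>t. arctan (s * tanh (t / 2))) has_real_derivative
        inverse (1 + (s * tanh (t / 2))\<^sup>2) * (s * ((1 - (tanh (t / 2))\<^sup>2) * (1 / 2)))) (at t)"
      by (rule DERIV_chain2[where f = arctan, OF DERIV_arctan])
    from DERIV_cmult[OF this, of "2 * a"] show ?thesis
      by (simp only: divide_inverse mult_1 mult_1_right) (simp add: mult_ac)
  qed
  from this[of "b / d"] have "(arc_primitive has_real_derivative
      a * (b / d) * (1 - (S / C)\<^sup>2) / (1 + (b / d * (S / C))\<^sup>2)) (at t)"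
    unfolding arc_primitive_def[abs_def] modulus_eq C_def S_def d_def tanh_def .
  also have "a * (b / d) * (1 - (S / C)\<^sup>2) / (1 + (b / d * (S / C))\<^sup>2)
      = a * b * d * (C\<^sup>2 - S\<^sup>2) / (d\<^sup>2 * C\<^sup>2 + b\<^sup>2 * S\<^sup>2)"
  proof -
    have 1: "1 - (S / C)\<^sup>2 = (C\<^sup>2 - S\<^sup>2) / C\<^sup>2"
      using C by (simp add: field_simps)
    have 2: "1 + (b / d * (S / C))\<^sup>2 = (d\<^sup>2 * C\<^sup>2 + b\<^sup>2 * S\<^sup>2) / (d\<^sup>2 * C\<^sup>2)"
      using C d by (simp add: field_simps)
    have "a * (b / d) * (M / C\<^sup>2) / (N / (d\<^sup>2 * C\<^sup>2)) = a * b * d * M / N" for M N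
      using C d by (simp add: power2_eq_square)
    then show ?thesis
      unfolding 1 2 .
  qed
  also have "C\<^sup>2 - S\<^sup>2 = 1"
    using CS by simp
  \<comment> \<open>After b^2 = (c - \<sigma> a) d, a factor d splits off and leaves (c + \<sigma>
    a) C^2 + (c - \<sigma> a) S^2 = c (C^2 + S^2) + \<sigma> a (C^2 - S^2).\<close>
  also have "d\<^sup>2 * C\<^sup>2 + b\<^sup>2 * S\<^sup>2 = d * (c * cosh t + \<sigma> * a)"
    unfolding bd cosh_t using CS unfolding d_def by (simp add: algebra_simps power2_eq_square)
  finally show ?thesis
    using d by simp
qed

lemma has_real_derivative_arc_primitive_speed:
  "(arc_primitive has_real_derivative norm (velocity (roulette branch (\<sigma> * c, 0) t0) t)) (at t)"
  unfolding norm_velocity_roulette by (rule has_real_derivative_arc_primitive)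

lemma continuous_on_norm_velocity_roulette:
  "continuous_on UNIV (\<lambda>t. norm (velocity (roulette branch (\<sigma> * c, 0) t0) t))"
  unfolding norm_velocity_roulette
  using focal_factor_pos(2) by (intro continuous_intros) (auto simp: less_imp_neq[symmetric])

lemma signed_arc_length_roulette:
  "signed_arc_length (roulette branch (\<sigma> * c, 0) t0) t0 t = arc_primitive t - arc_primitive t0"
  by (rule signed_arc_length_eq_primitive[OF has_real_derivative_arc_primitive_speed
        continuous_on_norm_velocity_roulette])

text \<open>\<open>tanh (t / 2)\<close> tends to 1 and -1 at the two ends, and arctan is continuous
  and odd, so the two limits of the primitive are opposite and their difference doubles the
  coefficient 2 a.\<close>

lemma total_length_roulette:
  "total_length (roulette branch (\<sigma> * c, 0) t0) =
    ennreal (4 * a * arctan (sqrt ((c - \<sigma> * a) / (c + \<sigma> * a))))"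
proof -
  let ?s = "sqrt ((c - \<sigma> * a) / (c + \<sigma> * a))"
  have half: "filterlim (\<lambda>t::real. t / 2) at_top at_top" "filterlim (\<lambda>t::real. t / 2) at_bot at_bot"
    using filterlim_tendsto_pos_mult_at_top[OF tendsto_const[of "1 / 2"] _ filterlim_ident]
      filterlim_tendsto_pos_mult_at_bot[OF tendsto_const[of "1 / 2"] _ filterlim_ident]
    by simp_all
  have "(arc_primitive \<longlongrightarrow> 2 * a * arctan (?s * 1)) at_top"
    unfolding arc_primitive_def
    by (intro tendsto_intros filterlim_compose[OF tanh_real_at_top half(1)])
  moreover have "(arc_primitive \<longlongrightarrow> 2 * a * arctan (?s * (- 1))) at_bot"
    unfolding arc_primitive_def
    by (intro tendsto_intros filterlim_compose[OF tanh_real_at_bot half(2)])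
  ultimately have "total_length (roulette branch (\<sigma> * c, 0) t0) =
      ennreal (2 * a * arctan (?s * 1) - 2 * a * arctan (?s * (- 1)))"
    by (intro total_length_eq_primitive[OF has_real_derivative_arc_primitive_speed
          continuous_on_norm_velocity_roulette])
  then show ?thesis
    by (simp add: arctan_minus algebra_simps)
qed

end

text \<open>The half-angle formula tan(x/2) = sin x / (1 + cos x) for the angle x with tan x = b/a,
  sin x = b/c and cos x = a/c.\<close>

lemma arctan_modulus: "4 * a * arctan (sqrt ((c - a) / (c + a))) = 2 * a * arctan (b / a)"
proof -
  have s: "sqrt ((c - a) / (c + a)) = b / (c + a)"
    using modulus_eq[of 1] by simp
  have bca: "b\<^sup>2 = c\<^sup>2 - a\<^sup>2"
    by (simp add: c_square)
  \<comment> \<open>Doubling the arctangent without a jump by pi requires an argument of absolute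
    value below 1, that is b < c + a.\<close>
  have "b\<^sup>2 < (c + a)\<^sup>2"
    unfolding bca using a_pos a_less_c by (simp add: power2_sum add_pos_pos)
  then have b_less: "b < c + a"
    using a_pos a_less_c by (intro power_less_imp_less_base[of b 2]) auto
  then have "2 * arctan (b / (c + a)) = arctan ((2 * (b / (c + a))) / (1 - (b / (c + a))\<^sup>2))"
    using b_pos by (intro arctan_double) auto
  also have "1 - (b / (c + a))\<^sup>2 = ((c + a)\<^sup>2 - b\<^sup>2) / (c + a)\<^sup>2"
    using a_pos a_less_c by (simp add: power_divide diff_divide_distrib)
  also have "(c + a)\<^sup>2 - b\<^sup>2 = (2 * a) * (c + a)"
    unfolding bca by (simp add: algebra_simps power2_eq_square)
  also have "2 * a * (c + a) / (c + a)\<^sup>2 = 2 * a / (c + a)"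
    by (simp add: power2_eq_square)
  also have "2 * (b / (c + a)) / (2 * a / (c + a)) = b / a"
    using a_pos a_less_c by simp
  finally show ?thesis
    unfolding s by simp
qed

lemma arctan_modulus_sum:
  "arctan (sqrt ((c - a) / (c + a))) + arctan (sqrt ((c + a) / (c - a))) = pi / 2"
proof -
  define s where "s = sqrt ((c - a) / (c + a))"
  \<comment> \<open>Positivity decides the sign: for negative \<open>s\<close> the sum would be - pi
    / 2.\<close>
  have "s > 0"
    unfolding s_def using a_less_c a_pos by simp
  then have "arctan s + arctan (inverse s) = pi / 2"
    by (simp add: arctan_inverse)
  moreover have "inverse s = sqrt ((c + a) / (c - a))"
    by (simp add: s_def flip: real_sqrt_inverse)
  ultimately show ?thesis
    by (simp add: s_def)
qed

end

theorem mainTheorem2: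
  fixes a b c t0 :: real
    and \<gamma> C1 C2 :: "real \<Rightarrow> plane"
    and F F' :: plane
  assumes "a > 0" and "b > 0"
    and "c = sqrt (a\<^sup>2 + b\<^sup>2)"
    and "\<gamma> = (\<lambda>t. (a * cosh t, b * sinh t))"
    and "F = (c, 0)" and "F' = (- c, 0)"
    and "C1 = roulette \<gamma> F t0"
    and "C2 = roulette \<gamma> F' t0"
  shows
    "((\<forall>t. C1 t =
          ((LBINT z=t0..t. sqrt (c\<^sup>2 * (cosh z)\<^sup>2 - a\<^sup>2))
             - c * sinh t * (c * cosh t - a) / sqrt (c\<^sup>2 * (cosh t)\<^sup>2 - a\<^sup>2),
           b * (c * cosh t - a) / sqrt (c\<^sup>2 * (cosh t)\<^sup>2 - a\<^sup>2)))
      \<and> (\<forall>t. C1 differentiable (at t)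
            \<and> norm (velocity C1 t) = a * b / (c * cosh t + a))
      \<and> (\<forall>t. signed_arc_length C1 t0 t =
            2 * a * arctan (sqrt ((c - a) / (c + a)) * tanh (t / 2))
              - 2 * a * arctan (sqrt ((c - a) / (c + a)) * tanh (t0 / 2)))
      \<and> total_length C1 = ennreal (4 * a * arctan (sqrt ((c - a) / (c + a))))
      \<and> 4 * a * arctan (sqrt ((c - a) / (c + a))) = 2 * a * arctan (b / a))
     \<and>
     ((\<forall>t. C2 t =
          ((LBINT z=t0..t. sqrt (c\<^sup>2 * (cosh z)\<^sup>2 - a\<^sup>2))
             - c * sinh t * (c * cosh t + a) / sqrt (c\<^sup>2 * (cosh t)\<^sup>2 - a\<^sup>2),
           b * (c * cosh t + a) / sqrt (c\<^sup>2 * (cosh t)\<^sup>2 - a\<^sup>2)))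
      \<and> (\<forall>t. C2 differentiable (at t)
            \<and> norm (velocity C2 t) = a * b / (c * cosh t - a))
      \<and> (\<forall>t. signed_arc_length C2 t0 t =
            2 * a * arctan (sqrt ((c + a) / (c - a)) * tanh (t / 2))
              - 2 * a * arctan (sqrt ((c + a) / (c - a)) * tanh (t0 / 2))))
     \<and>
     total_length C1 + total_length C2 = ennreal (2 * pi * a)"
proof -
  interpret hyperbola a b c
    by unfold_locales fact+
  have \<gamma>: "\<gamma> = branch"
    using assms(4) by (simp add: branch_def[abs_def])
  \<comment> \<open>The foci are written with explicit factors 1 and -1 to match the form (\<sigma>
    c, 0) of the common results.\<close>
  have C1: "C1 = roulette branch (1 * c, 0) t0" and C2: "C2 = roulette branch (- 1 * c, 0) t0"
    using assms(5-8) \<gamma> by simp_all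
  have signs: "(1::real) = 1 \<or> (1::real) = - 1" "(- 1::real) = 1 \<or> (- 1::real) = - 1"
    by simp_all
  have diff1: "C1 differentiable at t" and diff2: "C2 differentiable at t" for t
    unfolding C1 C2
    by (rule differentiableI_vector, rule has_vector_derivative_roulette, simp)+
  have "total_length C1 + total_length C2 =
      ennreal (4 * a * (arctan (sqrt ((c - a) / (c + a))) + arctan (sqrt ((c + a) / (c - a)))))"
    \<comment> \<open>Both lengths are nonnegative reals, so their extended sum is the embedding of
      the real sum.\<close>
    unfolding C1 C2 total_length_roulette[OF signs(1)] total_length_roulette[OF signs(2)]
    using a_pos a_less_c by (simp add: ennreal_plus[symmetric] distrib_left del: ennreal_plus)
  also have "\<dots> = ennreal (2 * pi * a)"
    unfolding arctan_modulus_sum by (simp add: mult_ac)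
  finally have sum: "total_length C1 + total_length C2 = ennreal (2 * pi * a)" .
  show ?thesis
    using diff1 diff2 sum arctan_modulus
      roulette_branch[OF signs(1), of t0] roulette_branch[OF signs(2), of t0]
      norm_velocity_roulette[OF signs(1), of t0] norm_velocity_roulette[OF signs(2), of t0]
      signed_arc_length_roulette[OF signs(1), of t0] signed_arc_length_roulette[OF signs(2), of t0]
      total_length_roulette[OF signs(1), of t0]
    unfolding C1 C2 speed_def arc_primitive_def[OF signs(1)] arc_primitive_def[OF signs(2)]
    by simp
qed

end
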